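(* Let $f$ be a convex function and $x_0\in\operatorname{dom} f$. Denote $K=\{x: f(x)\le f(x_0)\}$ and assume that $f\in\mathcal{H}_{s,L}\cap\mathcal{L}_{r,\mu}(K)$. Put $\rho=\frac{3s}{2}-1$, $\kappa=L^{2/s}/\mu^{2/r}$, $\tau=1-s/r\in[0,1)$ and $c=8e^{2/e}$. For a given $\epsilon_0\ge f(x_0)-f^*$, run from $x_0$ the universal scheduled restart scheme $$\epsilon_k=e^{-\gamma}\epsilon_{k-1},\qquad x_k=\mathcal{U}(x_{k-1},\epsilon_k,t_k),\qquad k=1,\dots,R,$$ with $$\gamma=\rho,\qquad t_k=C^*_{\kappa,\tau,\rho}e^{\tau k},\qquad C^*_{\kappa,\tau,\rho}=e^{1-\tau}(c\kappa)^{\frac{s}{2\rho}}\epsilon_0^{-\frac{\tau}{\rho}}.$$ The precision reached at the last point $\hat x=x_R$ is given by $$f(\hat x)-f^*\le\exp\left(-\rho e^{-1}(c\kappa)^{-\frac{s}{2\rho}}N\right)\epsilon_0=O\left(\exp(-\kappa^{-\frac{s}{2\rho}}N)\right),\quad\text{when }\tau=0,$$ while $$f(\hat x)-f^*\le\frac{\epsilon_0}{\left(\tau e^{-1}(c\kappa)^{-\frac{s}{2\rho}}\epsilon_0^{\frac{\tau}{\rho}}N+1\right)^{\frac{\rho}{\tau}}}=O\left(N^{-\frac{\rho}{\tau}}\right),\quad\text{when }\tau>0,$$ where $N=\sum_{k=1}^R t_k$ is the total number of iterations.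
   Context: $f$ is defined on $\mathbb{R}^n$; $X^*$ is its set of minimizers and $f^*$ its minimum. $1\le s\le2$, $L>0$, $\mu>0$, $r\ge1$ are constants. $\mathcal{H}_{s,L}$ is the set of functions $f$ with $\|\nabla f(x)-\nabla f(y)\|_2\le L\|x-y\|_2^{s-1}$ for all $x,y\in\operatorname{dom} f$ and any subgradients $\nabla f(x)\in\partial f(x)$, $\nabla f(y)\in\partial f(y)$. $\mathcal{L}_{r,\mu}(K)$ is the set of functions $f$ satisfying the Łojasiewicz growth condition $\frac{\mu}{r}d(x,X^* )^r\le f(x)-f^*$ for every $x\in K$, where $d(x,X^* )=\min_{y\in X^*}\|x-y\|_2$. $\mathcal{U}$ denotes the universal fast gradient method with monotone objective values: given a starting point $x$, a target accuracy $\epsilon$ and a number of iterations $t$, it outputs a point $y=\mathcal{U}(x,\epsilon,t)$ such that $$f(y)-f^*\le\frac{\epsilon}{2}+\frac{c_0L^{2/s}d(x,X^* )^2}{\epsilon^{2/s}t^{2\rho/s}}\,\frac{\epsilon}{2},\qquad c_0=2^{\frac{4s-2}{s}},\qquad\text{and}\qquad f(y)\le f(x).$$ Iteration counts $t_k$ are treated as real numbers (rounding to integers is ignored).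
   Formalization: For τ=0 the O-term is stated as O(exp(-ρ e^{-1} c^{-s/(2ρ)} κ^{-s/(2ρ)} N)), since the displayed bound is not O(exp(-κ^{-s/(2ρ)} N)): the factor ρ e^{-1} c^{-s/(2ρ)} is below 1 (about 0.18 for s=2). *)

theory Defs
  imports "HOL-Analysis.Analysis" "HOL-Library.Landau_Symbols"
begin

text \<open>A convex function on \<open>\<real>\<^sup>n\<close> with values in \<open>\<real> \<union> {+\<infinity>}\<close> is represented by its effective
  domain \<open>D\<close> and a real-valued \<open>f\<close> of which only the values on \<open>D\<close> are used; \<open>D = UNIV\<close> is the
  finite-valued case.\<close>

definition minimizers :: "(real^'n) set \<Rightarrow> (real^'n \<Rightarrow> real) \<Rightarrow> (real^'n) set" where
  "minimizers D f = {x. is_arg_min f (\<lambda>x. x \<in> D) x}"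

text \<open>The infimum is a minimum whenever \<^term>\<open>minimizers D f \<noteq> {}\<close>.\<close>

definition min_value :: "(real^'n) set \<Rightarrow> (real^'n \<Rightarrow> real) \<Rightarrow> real" where
  "min_value D f = (INF x\<in>D. f x)"

definition subdifferential ::
    "(real^'n) set \<Rightarrow> (real^'n \<Rightarrow> real) \<Rightarrow> real^'n \<Rightarrow> (real^'n) set" where
  "subdifferential D f x = {g. \<forall>y\<in>D. f y \<ge> f x + g \<bullet> (y - x)}"

text \<open>The class \<open>\<H>\<^sub>s\<^sub>,\<^sub>L\<close>. For \<open>s = 1\<close> the bound has to read \<open>\<parallel>g - h\<parallel> \<le> L\<close>, also when \<open>x = y\<close>;
  since \<^term>\<open>0 powr 0 = (0::real)\<close> in HOL, the exponent 0 is treated separately.\<close>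

definition holder_class :: "(real^'n) set \<Rightarrow> real \<Rightarrow> real \<Rightarrow> (real^'n \<Rightarrow> real) set" where
  "holder_class D s L =
     {f. \<forall>x\<in>D. \<forall>y\<in>D. \<forall>g\<in>subdifferential D f x. \<forall>h\<in>subdifferential D f y.
           norm (g - h) \<le> L * (if s = 1 then 1 else norm (x - y) powr (s - 1))}"

text \<open>The class \<open>\<L>\<^sub>r\<^sub>,\<^sub>\<mu>(K)\<close>. For a nonempty set of minimizers \<^const>\<open>infdist\<close> is the infimum of
  the distances, attained if that set is closed (in particular for convex \<open>f\<close> on \<open>D = UNIV\<close>).\<close>

definition lojasiewicz_class ::
    "(real^'n) set \<Rightarrow> real \<Rightarrow> real \<Rightarrow> (real^'n) set \<Rightarrow> (real^'n \<Rightarrow> real) set" where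
  "lojasiewicz_class D r \<mu> K =
     {f. \<forall>x\<in>K. \<mu> / r * infdist x (minimizers D f) powr r \<le> f x - min_value D f}"

text \<open>The method is known only through its guarantee: \<open>U x \<epsilon> t\<close> is the output for starting point
  \<open>x\<close>, target accuracy \<open>\<epsilon>\<close> and \<open>t\<close> iterations, \<open>t\<close> being a real number.\<close>

definition universal_fast_gradient ::
    "(real^'n) set \<Rightarrow> (real^'n \<Rightarrow> real) \<Rightarrow> real \<Rightarrow> real \<Rightarrow>
     (real^'n \<Rightarrow> real \<Rightarrow> real \<Rightarrow> real^'n) \<Rightarrow> bool" where
  "universal_fast_gradient D f s L U \<longleftrightarrow>
     (\<forall>x\<in>D. \<forall>\<epsilon>>0. \<forall>t>0.
        let \<rho> = 3 * s / 2 - 1; c\<^sub>0 = 2 powr ((4 * s - 2) / s); y = U x \<epsilon> t in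
          y \<in> D \<and>
          f y - min_value D f \<le> \<epsilon> / 2 +
            c\<^sub>0 * L powr (2 / s) * (infdist x (minimizers D f))\<^sup>2
              / (\<epsilon> powr (2 / s) * t powr (2 * \<rho> / s)) * (\<epsilon> / 2) \<and>
          f y \<le> f x)"

end

theory Submission
  imports Defs
begin

text \<open>The schedule is chosen so that the guarantee of the method can be iterated from restart to
  restart: by the growth condition a gap of at most \<open>\<epsilon>\<^sub>k\<^sub>-\<^sub>1\<close> bounds the distance to the minimizers,
  and \<open>t\<^sub>k\<close> makes the second term of the guarantee at most \<open>\<epsilon>\<^sub>k / 2\<close>, so that the gap at \<open>x\<^sub>k\<close> is at
  most \<open>\<epsilon>\<^sub>k = exp (- \<rho> k) \<epsilon>\<^sub>0\<close>. The constant \<open>c\<close> absorbs \<open>2\<^bsup>(4 s - 2) / s\<^esup> \<le> 8\<close> and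
  \<open>r\<^bsup>2 / r\<^esup> \<le> exp (2 / e)\<close>. It remains to express \<open>R\<close> through \<open>N\<close>, a geometric sum, using
  \<open>\<tau> \<le> exp \<tau> - 1\<close>.\<close>

text \<open>The function ln r / r peaks at r = e with value 1 / e, which follows from ln u <= u - 1
  at u = r / e. With \<open>a = 2\<close> this produces the factor \<open>exp (2 / exp 1)\<close> of
  \<open>c\<close>, uniformly in \<open>r\<close>.\<close>

lemma powr_inverse_self_le:
  fixes r :: real
  assumes "r > 0" "a \<ge> 0"
  shows "r powr (a / r) \<le> exp (a / exp 1)"
proof -
  have "ln (r / exp 1) \<le> r / exp 1 - 1"
    using assms by (intro ln_le_minus_one) simp
  then have "ln r / r \<le> 1 / exp 1"
    using assms by (simp add: ln_div field_simps)
  then have "a * (ln r / r) \<le> a * (1 / exp 1)"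
    using assms(2) by (rule mult_left_mono)
  then show ?thesis
    using assms by (simp add: powr_def)
qed

lemma two_powr_le_8:
  fixes s :: real
  assumes "1 \<le> s" "s \<le> 2"
  shows "2 powr ((4 * s - 2) / s) \<le> 8"
proof -
  have "2 powr ((4 * s - 2) / s) \<le> 2 powr 3"
    using assms by (intro powr_mono) (simp_all add: field_simps)
  then show ?thesis by simp
qed

lemma power2_le_of_growth:
  fixes d r \<mu> \<delta> :: real
  assumes "d \<ge> 0" "r > 0" "\<mu> > 0" "\<mu> / r * d powr r \<le> \<delta>"
  shows "d\<^sup>2 \<le> r powr (2 / r) / \<mu> powr (2 / r) * \<delta> powr (2 / r)"
proof -
  have \<delta>: "\<delta> \<ge> 0"
    using assms by (meson order_trans mult_nonneg_nonneg divide_nonneg_nonneg less_imp_le powr_ge_zero)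
  have "d powr r \<le> r / \<mu> * \<delta>"
    using assms by (simp add: field_simps)
  then have "(d powr r) powr (2 / r) \<le> (r / \<mu> * \<delta>) powr (2 / r)"
    using assms by (intro powr_mono2) auto
  moreover have "(d powr r) powr (2 / r) = d\<^sup>2"
    using assms by (cases "d = 0") (simp_all add: powr_powr)
  moreover have "(r / \<mu> * \<delta>) powr (2 / r) = r powr (2 / r) / \<mu> powr (2 / r) * \<delta> powr (2 / r)"
    using assms \<delta> by (simp add: powr_mult powr_divide)
  ultimately show ?thesis by simp
qed

text \<open>Taking logarithms leaves an identity linear in ln M, ln e and k. The powers of
  \<open>M\<close> and \<open>e\<close> in the schedule are tuned to it through 2/r = (2/s)(1 -
  \<tau>), and the factor \<open>exp (1 - \<tau>)\<close> shifts the index from k to k - 1, i.e. to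
  the accuracy of the previous restart.\<close>

lemma schedule_identity:
  fixes s r \<rho> M e \<tau> k :: real
  assumes "s > 0" "r > 0" "\<rho> > 0" "M > 0" "e > 0" "\<tau> = 1 - s / r"
  shows "(exp (- \<rho> * k) * e) powr (2 / s) *
      (exp (1 - \<tau>) * M powr (s / (2 * \<rho>)) * e powr (- \<tau> / \<rho>) * exp (\<tau> * k)) powr (2 * \<rho> / s)
    = M * (exp (- \<rho> * (k - 1)) * e) powr (2 / r)" (is "?l = ?r")
proof -
  have exponent: "2 / r = 2 / s * (1 - \<tau>)"
    using assms by simp
  have "ln ?l = ln ?r"
    unfolding exponent using assms(1,3-5) by (simp add: ln_mult ln_powr field_simps)
  then show ?thesis
    using assms by (subst (asm) ln_inj_iff) auto
qed

text \<open>The fraction is the factor of \<epsilon>/2 in the guarantee of the method, with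
  \<open>M\<close> in the role of c\<kappa> and \<open>d\<close> the distance from the starting
  point of restart k to the minimizers. Growth bounds the numerator by
  \<open>M * \<delta> powr (2 / r)\<close>, where \<delta> is the previous accuracy; by
  \<open>schedule_identity\<close> this is exactly the denominator.\<close>

lemma restart_factor_le_1:
  fixes s L r \<mu> \<rho> e \<tau> k d :: real
  assumes s: "1 \<le> s" "s \<le> 2" and "L > 0" "\<mu> > 0" "r > 0" "\<rho> > 0" "e > 0" "d \<ge> 0"
    and \<tau>: "\<tau> = 1 - s / r"
    and M: "M = 8 * exp (2 / exp 1) * (L powr (2 / s) / \<mu> powr (2 / r))"
    and growth: "\<mu> / r * d powr r \<le> exp (- \<rho> * (k - 1)) * e"
  shows "2 powr ((4 * s - 2) / s) * L powr (2 / s) * d\<^sup>2 /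
     ((exp (- \<rho> * k) * e) powr (2 / s) *
      (exp (1 - \<tau>) * M powr (s / (2 * \<rho>)) * e powr (- \<tau> / \<rho>) * exp (\<tau> * k)) powr (2 * \<rho> / s)) \<le> 1"
proof -
  define \<delta> where "\<delta> = exp (- \<rho> * (k - 1)) * e"
  have M0: "M > 0" unfolding M using assms by simp
  have \<delta>0: "\<delta> > 0" unfolding \<delta>_def using assms by simp
  have "d\<^sup>2 \<le> r powr (2 / r) / \<mu> powr (2 / r) * \<delta> powr (2 / r)"
    unfolding \<delta>_def using assms by (intro power2_le_of_growth)
  also have "\<dots> \<le> exp (2 / exp 1) / \<mu> powr (2 / r) * \<delta> powr (2 / r)"
    using powr_inverse_self_le[of r 2] assms
    by (intro mult_right_mono divide_right_mono) auto
  finally have "2 powr ((4 * s - 2) / s) * L powr (2 / s) * d\<^sup>2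
      \<le> 8 * L powr (2 / s) * (exp (2 / exp 1) / \<mu> powr (2 / r) * \<delta> powr (2 / r))"
    using two_powr_le_8[OF s] by (intro mult_mono) auto
  also have "\<dots> = M * \<delta> powr (2 / r)"
    by (simp add: M)
  finally show ?thesis
    using schedule_identity[of s r \<rho> M e \<tau> k] M0 \<delta>0 assms(1-9) by (simp add: \<delta>_def)
qed

text \<open>A real \<open>INF\<close> is a lower bound only for a set bounded below; the value at a
  minimizer supplies the bound.\<close>

lemma min_value_le:
  assumes "minimizers D f \<noteq> {}" "y \<in> D"
  shows "min_value D f \<le> f y"
proof -
  obtain z where "is_arg_min f (\<lambda>x. x \<in> D) z"
    using assms(1) by (auto simp: minimizers_def)
  then have "bdd_below (f ` D)"
    by (intro bdd_belowI[of _ "f z"]) (auto simp: is_arg_min_linorder)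
  then show ?thesis
    unfolding min_value_def using assms(2) by (rule cINF_lower)
qed

text \<open>By \<tau> <= exp \<tau> - 1, the k-th term on the left is at most exp(\<tau>k) -
  exp(\<tau>(k - 1)), and these differences telescope.\<close>

lemma sum_exp_geometric_le:
  fixes \<tau> :: real
  assumes "\<tau> > 0"
  shows "\<tau> * exp (- \<tau>) * (\<Sum>k=1..R. exp (\<tau> * real k)) + 1 \<le> exp (\<tau> * real R)"
proof (induction R)
  case (Suc R)
  have "\<tau> \<le> exp \<tau> - 1"
    using exp_ge_add_one_self[of \<tau>] by linarith
  then have "\<tau> * exp (\<tau> * real R) \<le> (exp \<tau> - 1) * exp (\<tau> * real R)"
    by (intro mult_right_mono) auto
  moreover have "exp (- \<tau>) * exp (\<tau> * real (Suc R)) = exp (\<tau> * real R)"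
    by (simp flip: exp_add add: algebra_simps)
  moreover have "exp \<tau> * exp (\<tau> * real R) = exp (\<tau> * real (Suc R))"
    by (simp flip: exp_add add: algebra_simps)
  ultimately show ?case
    using Suc by (simp add: algebra_simps)
qed simp

text \<open>Dropping the 1 shrinks the denominator. At n = 0 the right-hand side would be 0, as
  \<open>0 powr a = 0\<close> in HOL.\<close>

lemma divide_affine_powr_le:
  fixes a b p n :: real
  assumes "a \<ge> 0" "b > 0" "p \<ge> 0" "n > 0"
  shows "a / (b * n + 1) powr p \<le> a * b powr (- p) * n powr (- p)"
proof -
  have "b * n > 0"
    using assms by simp
  moreover from this have "b * n + 1 \<noteq> 0"
    by linarith
  ultimately have "a / (b * n + 1) powr p \<le> a / (b * n) powr p"
    using assms by (intro divide_left_mono powr_mono2 mult_pos_pos) auto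
  also have "\<dots> = a * b powr (- p) * n powr (- p)"
    using assms by (simp add: powr_mult powr_minus divide_inverse)
  finally show ?thesis .
qed

theorem proposition3p1:
  fixes f :: "real^'n \<Rightarrow> real" and D :: "(real^'n) set"
    and U :: "real^'n \<Rightarrow> real \<Rightarrow> real \<Rightarrow> real^'n"
    and x :: "nat \<Rightarrow> real^'n" and \<epsilon> t N :: "nat \<Rightarrow> real"
    and s L r \<mu> \<rho> \<kappa> \<tau> c \<gamma> C :: real
  assumes "1 \<le> s" "s \<le> 2" "L > 0" "\<mu> > 0" "r \<ge> 1"
    and "\<rho> = 3 * s / 2 - 1"
    and "\<kappa> = L powr (2 / s) / \<mu> powr (2 / r)"
    and "\<tau> = 1 - s / r" "\<tau> \<in> {0..<1}"
    and "c = 8 * exp (2 / exp 1)"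
    and "convex_on D f"
    and "minimizers D f \<noteq> {}"
    and "x 0 \<in> D"
    and "f \<in> holder_class D s L \<inter> lojasiewicz_class D r \<mu> {z \<in> D. f z \<le> f (x 0)}"
    and "universal_fast_gradient D f s L U"
    and "\<epsilon> 0 \<ge> f (x 0) - min_value D f" "\<epsilon> 0 > 0"
    and "\<gamma> = \<rho>"
    and "C = exp (1 - \<tau>) * (c * \<kappa>) powr (s / (2 * \<rho>)) * \<epsilon> 0 powr (- \<tau> / \<rho>)"
    and "\<And>k. k \<ge> 1 \<Longrightarrow> t k = C * exp (\<tau> * real k)"
    and "\<And>k. k \<ge> 1 \<Longrightarrow> \<epsilon> k = exp (- \<gamma>) * \<epsilon> (k - 1)"
    and "\<And>k. k \<ge> 1 \<Longrightarrow> x k = U (x (k - 1)) (\<epsilon> k) (t k)"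
    and "\<And>R. N R = (\<Sum>k=1..R. t k)"
  shows
    "(\<tau> = 0 \<longrightarrow>
        (\<forall>R. f (x R) - min_value D f
               \<le> exp (- \<rho> * exp (- 1) * (c * \<kappa>) powr (- s / (2 * \<rho>)) * N R) * \<epsilon> 0) \<and>
        (\<lambda>n::real. exp (- \<rho> * exp (- 1) * (c * \<kappa>) powr (- s / (2 * \<rho>)) * n) * \<epsilon> 0)
          \<in> O[at_top](\<lambda>n. exp (- (\<rho> * exp (- 1) * c powr (- s / (2 * \<rho>)))
                                   * \<kappa> powr (- s / (2 * \<rho>)) * n)) \<and>
        (\<lambda>R. f (x R) - min_value D f)
          \<in> O[sequentially](\<lambda>R. exp (- (\<rho> * exp (- 1) * c powr (- s / (2 * \<rho>)))
                                   * \<kappa> powr (- s / (2 * \<rho>)) * N R))) \<and>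
     (\<tau> > 0 \<longrightarrow>
        (\<forall>R. f (x R) - min_value D f
               \<le> \<epsilon> 0 / (\<tau> * exp (- 1) * (c * \<kappa>) powr (- s / (2 * \<rho>)) * \<epsilon> 0 powr (\<tau> / \<rho>) * N R + 1)
                         powr (\<rho> / \<tau>)) \<and>
        (\<lambda>n::real. \<epsilon> 0 / (\<tau> * exp (- 1) * (c * \<kappa>) powr (- s / (2 * \<rho>)) * \<epsilon> 0 powr (\<tau> / \<rho>) * n + 1)
                         powr (\<rho> / \<tau>))
          \<in> O[at_top](\<lambda>n. n powr (- \<rho> / \<tau>)) \<and>
        (\<lambda>R. f (x R) - min_value D f) \<in> O[sequentially](\<lambda>R. N R powr (- \<rho> / \<tau>)))"
proof -
  define gap where "gap R = f (x R) - min_value D f" for R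
  define A where "A = (c * \<kappa>) powr (- s / (2 * \<rho>))"
  have s: "s > 0" and \<rho>: "\<rho> > 0" and r: "r > 0" and c: "c > 0" and \<kappa>: "\<kappa> > 0"
    and A: "A > 0"
    using assms(1-10) by (simp_all add: A_def)
  have C: "C > 0"
    unfolding assms(19) using c \<kappa> assms(17) by simp
  have t: "t k > 0" if "k \<ge> 1" for k
    using assms(20)[OF that] C by simp
  have \<epsilon>: "\<epsilon> k = exp (- \<rho> * real k) * \<epsilon> 0" for k
  proof (induction k)
    case (Suc k)
    then show ?case
      using assms(21)[of "Suc k"] assms(18)
      by (simp add: algebra_simps flip: exp_add mult.assoc)
  qed simp
  \<comment> \<open>Membership in \<open>D\<close> and monotonicity keep every iterate in the
    sublevel set where growth is assumed; growth then turns the bound on the gap into a bound on the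
    distance, which the next restart needs.\<close>
  have iter: "x k \<in> D \<and> f (x k) \<le> f (x 0) \<and> gap k \<le> \<epsilon> k" for k
  proof (induction k)
    case 0
    show ?case using assms(13,16) by (simp add: gap_def)
  next
    case (Suc k)
    define d where "d = infdist (x k) (minimizers D f)"
    define F where "F = 2 powr ((4 * s - 2) / s) * L powr (2 / s) * d\<^sup>2
      / (\<epsilon> (Suc k) powr (2 / s) * t (Suc k) powr (2 * \<rho> / s))"
    have \<epsilon>_pos: "\<epsilon> (Suc k) > 0"
      using \<epsilon>[of "Suc k"] assms(17) by simp
    have U: "x (Suc k) \<in> D" "gap (Suc k) \<le> \<epsilon> (Suc k) / 2 + F * (\<epsilon> (Suc k) / 2)"
        "f (x (Suc k)) \<le> f (x k)"
      using assms(15) Suc \<epsilon>_pos t[of "Suc k"] assms(22)[of "Suc k"]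
      by (simp_all add: universal_fast_gradient_def Let_def assms(6) gap_def F_def d_def)
    have "\<mu> / r * d powr r \<le> gap k"
      using assms(14) Suc by (simp add: lojasiewicz_class_def gap_def d_def)
    then have growth: "\<mu> / r * d powr r \<le> exp (- \<rho> * (real (Suc k) - 1)) * \<epsilon> 0"
      using Suc \<epsilon>[of k] by simp
    have "F \<le> 1"
      unfolding F_def \<epsilon>[of "Suc k"]
      using restart_factor_le_1[OF assms(1-4) r \<rho> assms(17) _ assms(8) _ growth, of "c * \<kappa>"]
        assms(7,10,19) assms(20)[of "Suc k"]
      by (simp add: d_def infdist_nonneg)
    then have "F * (\<epsilon> (Suc k) / 2) \<le> \<epsilon> (Suc k) / 2"
      using \<epsilon>_pos by simp
    then show ?case
      using U Suc by auto
  qed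
  have gap_le: "gap R \<le> exp (- \<rho> * real R) * \<epsilon> 0" for R
    using iter[of R] \<epsilon>[of R] by simp
  \<comment> \<open>The O-statements bound the absolute value of the gap, so its sign is
    needed.\<close>
  have gap_ge: "gap R \<ge> 0" for R
    using min_value_le[OF assms(12), of "x R"] iter[of R] by (simp add: gap_def)
  have N: "N R = C * (\<Sum>k=1..R. exp (\<tau> * real k))" for R
    using assms(20,23) by (simp add: sum_distrib_left)
  \<comment> \<open>\<open>A\<close> and the power of \<open>\<epsilon> 0\<close> cancel their
    inverses in \<open>C\<close>. What is left is 1 if \<tau> = 0, and otherwise the constant in
    front of the sum in \<open>sum_exp_geometric_le\<close>.\<close>
  have AC: "exp (- 1) * A * \<epsilon> 0 powr (\<tau> / \<rho>) * C = exp (- \<tau>)"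
  proof -
    have "A * (c * \<kappa>) powr (s / (2 * \<rho>)) = 1"
      using c \<kappa> by (simp add: A_def flip: powr_add)
    moreover have "\<epsilon> 0 powr (\<tau> / \<rho>) * \<epsilon> 0 powr (- \<tau> / \<rho>) = 1"
      using assms(17) by (simp flip: powr_add)
    moreover have "exp (- 1) * exp (1 - \<tau>) = exp (- \<tau>)"
      by (simp flip: exp_add)
    moreover have "exp (- 1) * A * \<epsilon> 0 powr (\<tau> / \<rho>) * C
        = (exp (- 1) * exp (1 - \<tau>)) * (A * (c * \<kappa>) powr (s / (2 * \<rho>)))
          * (\<epsilon> 0 powr (\<tau> / \<rho>) * \<epsilon> 0 powr (- \<tau> / \<rho>))"
      unfolding assms(19) by (simp only: mult_ac)
    ultimately show ?thesis by simp
  qed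
  have A_split: "c powr (- s / (2 * \<rho>)) * \<kappa> powr (- s / (2 * \<rho>)) = A"
    using c \<kappa> by (simp add: A_def powr_mult)

  have linear: "(\<forall>R. gap R \<le> exp (- \<rho> * exp (- 1) * A * N R) * \<epsilon> 0) \<and>
      (\<lambda>n::real. exp (- \<rho> * exp (- 1) * A * n) * \<epsilon> 0)
        \<in> O[at_top](\<lambda>n. exp (- (\<rho> * exp (- 1) * c powr (- s / (2 * \<rho>))) * \<kappa> powr (- s / (2 * \<rho>)) * n)) \<and>
      gap \<in> O[sequentially](\<lambda>R. exp (- (\<rho> * exp (- 1) * c powr (- s / (2 * \<rho>)))
                                   * \<kappa> powr (- s / (2 * \<rho>)) * N R))"
    if "\<tau> = 0"
  proof -
    \<comment> \<open>For \<tau> = 0 all restarts have the same length \<open>C\<close>, so N is R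
      times \<open>C\<close> and the claimed exponent is -\<rho>R, as in
      \<open>gap_le\<close>.\<close>
    have "exp (- 1) * A * C = 1"
      using AC that assms(17) by simp
    then have "exp (- 1) * A * N R = real R" for R
      by (simp add: N that flip: mult.assoc)
    then have rate: "- \<rho> * exp (- 1) * A * N R = - \<rho> * real R" for R
      by (simp add: mult.assoc)
    have split: "- (\<rho> * exp (- 1) * c powr (- s / (2 * \<rho>))) * \<kappa> powr (- s / (2 * \<rho>)) * n
        = - \<rho> * exp (- 1) * A * n" for n
      by (simp add: mult.assoc flip: A_split)
    have bound: "gap R \<le> exp (- \<rho> * exp (- 1) * A * N R) * \<epsilon> 0" for R
      using gap_le[of R] by (simp only: rate)
    have "gap \<in> O[sequentially](\<lambda>R. exp (- \<rho> * exp (- 1) * A * N R))"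
      using bound gap_ge by (intro bigoI[of _ "\<epsilon> 0"] always_eventually) (simp add: mult.commute)
    then show ?thesis
      unfolding split using bound by simp
  qed

  \<comment> \<open>By \<open>AC\<close>, b C = \<tau> exp(-\<tau>), so \<open>b * N R + 1\<close>
    is the left-hand side of \<open>sum_exp_geometric_le\<close>.\<close>
  define b where "b = \<tau> * exp (- 1) * A * \<epsilon> 0 powr (\<tau> / \<rho>)"
  have sublinear: "(\<forall>R. gap R \<le> \<epsilon> 0 / (b * N R + 1) powr (\<rho> / \<tau>)) \<and>
      (\<lambda>n::real. \<epsilon> 0 / (b * n + 1) powr (\<rho> / \<tau>)) \<in> O[at_top](\<lambda>n. n powr (- \<rho> / \<tau>)) \<and>
      gap \<in> O[sequentially](\<lambda>R. N R powr (- \<rho> / \<tau>))"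
    if \<tau>: "\<tau> > 0"
  proof -
    have b: "b > 0"
      using \<tau> A assms(17) by (simp add: b_def)
    have N_nonneg: "N R \<ge> 0" for R
      unfolding N using C by (intro mult_nonneg_nonneg sum_nonneg) auto
    \<comment> \<open>\<open>N 0 = 0\<close>, where the comparison function
      \<open>N R powr (- \<rho> / \<tau>)\<close> vanishes; hence the asymptotic bound starts at R =
      1.\<close>
    have N_pos: "N R > 0" if "R \<ge> 1" for R
      unfolding N using C that by (intro mult_pos_pos sum_pos) auto
    have bound: "gap R \<le> \<epsilon> 0 / (b * N R + 1) powr (\<rho> / \<tau>)" for R
    proof -
      have "b * N R = \<tau> * (exp (- 1) * A * \<epsilon> 0 powr (\<tau> / \<rho>) * C) * (\<Sum>k=1..R. exp (\<tau> * real k))"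
        unfolding b_def N by (simp only: mult_ac)
      then have "b * N R + 1 \<le> exp (\<tau> * real R)"
        unfolding AC using sum_exp_geometric_le[OF \<tau>] by simp
      moreover have pos: "b * N R + 1 > 0"
        using b N_nonneg[of R] by (simp add: add_nonneg_pos)
      ultimately have "(b * N R + 1) powr (\<rho> / \<tau>) \<le> exp (\<tau> * real R) powr (\<rho> / \<tau>)"
        using \<rho> \<tau> by (intro powr_mono2) auto
      \<comment> \<open>The power \<rho>/\<tau> converts the growth rate \<tau> of the iteration
        counts into the decay rate \<rho> of the accuracies.\<close>
      also have "\<dots> = exp (\<rho> * real R)"
        using \<tau> by (simp add: powr_def)
      finally have "\<epsilon> 0 / exp (\<rho> * real R) \<le> \<epsilon> 0 / (b * N R + 1) powr (\<rho> / \<tau>)"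
        using pos assms(17) by (intro divide_left_mono) auto
      then show ?thesis
        using gap_le[of R] by (simp add: exp_minus divide_inverse mult.commute)
    qed
    have aff: "\<epsilon> 0 / (b * n + 1) powr (\<rho> / \<tau>) \<le> \<epsilon> 0 * b powr (- (\<rho> / \<tau>)) * n powr (- \<rho> / \<tau>)"
      if "n > 0" for n
      using divide_affine_powr_le[of "\<epsilon> 0" b "\<rho> / \<tau>" n] that b \<rho> \<tau> assms(17) by simp
    have "(\<lambda>n::real. \<epsilon> 0 / (b * n + 1) powr (\<rho> / \<tau>)) \<in> O[at_top](\<lambda>n. n powr (- \<rho> / \<tau>))"
      using aff assms(17)
      by (intro bigoI[of _ "\<epsilon> 0 * b powr (- (\<rho> / \<tau>))"]
          eventually_mono[OF eventually_gt_at_top[of 0]]) auto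
    moreover have "gap \<in> O[sequentially](\<lambda>R. N R powr (- \<rho> / \<tau>))"
      using order_trans[OF bound aff[OF N_pos]] gap_ge
      by (intro bigoI[of _ "\<epsilon> 0 * b powr (- (\<rho> / \<tau>))"]
          eventually_mono[OF eventually_ge_at_top[of 1]]) auto
    ultimately show ?thesis
      using bound by blast
  qed
  show ?thesis
    using linear sublinear unfolding gap_def[abs_def] A_def b_def by blast
qed

end
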